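(* Let $X$ be an infinite compact Hausdorff topological space whose weight is smaller than $\operatorname{cov}(\mathcal{M})$. Then $X$ contains a non-trivial convergent sequence: there exist a sequence $(a_n)_{n<\omega}$ of points of $X$ that is not eventually constant and a point $a\in X$ such that $a_n\to a$.
   Context: The weight of a topological space is the minimal cardinality of a base of its topology. A subset of a topological space is nowhere dense if its closure has empty interior, and meagre if it is a countable union of nowhere dense sets. $\mathcal{M}$ denotes the ideal of all meagre subsets of the Cantor space $2^\omega$ (infinite $0$-$1$ sequences with the product topology, equivalently with the metric assigning to two distinct sequences the distance $2^{-n}$, where $n$ is the first place at which they differ). $\operatorname{cov}(\mathcal{M})=\min\{|\mathcal{A}|: \mathcal{A}\subseteq\mathcal{M},\ \bigcup\mathcal{A}=2^\omega\}$. A sequence $(a_n)$ converges to $a$ if every open neighbourhood of $a$ contains all but finitely many terms of the sequence. A sequence is trivial if it is eventually constant, and non-trivial otherwise. *)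

theory Defs
  imports "HOL-Analysis.Analysis"
begin

unbundle cardinal_syntax

text \<open>
  The minimal cardinality of a member of a family of sets, as a cardinal order.  Cardinals of
  sets over different types are compared by \<open>\<le>o\<close> and \<open><o\<close>.
\<close>

definition min_card :: "'a set set \<Rightarrow> 'a rel" where
  "min_card \<F> = |SOME A. A \<in> \<F> \<and> (\<forall>B\<in>\<F>. |A| \<le>o |B| )|"

lemma min_card_props:
  assumes "\<F> \<noteq> {}"
  shows "\<exists>A\<in>\<F>. min_card \<F> = |A|" and "\<And>B. B \<in> \<F> \<Longrightarrow> min_card \<F> \<le>o |B|"
proof -
  let ?P = "\<lambda>A. A \<in> \<F> \<and> (\<forall>B\<in>\<F>. |A| \<le>o |B| )"
  have "\<exists>r\<in>card_of ` \<F>. \<forall>r'\<in>card_of ` \<F>. r \<le>o r'"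
    using assms by (intro exists_minim_Card_order) (auto simp: card_of_Card_order)
  then have "\<exists>A. ?P A"
    by blast
  then have P: "?P (SOME A. ?P A)"
    by (rule someI_ex)
  then show "\<exists>A\<in>\<F>. min_card \<F> = |A|"
    unfolding min_card_def by (elim conjE) (rule bexI[where x = "SOME A. ?P A"], rule refl)
  show "min_card \<F> \<le>o |B|" if "B \<in> \<F>" for B
    unfolding min_card_def using conjunct2[OF P] that by (rule bspec)
qed

definition base_of :: "'a topology \<Rightarrow> 'a set set \<Rightarrow> bool" where
  "base_of X \<B> \<longleftrightarrow> openin X = (arbitrary union_of (\<lambda>U. U \<in> \<B>))"

definition weight :: "'a topology \<Rightarrow> 'a set rel" where
  "weight X = min_card {\<B>. base_of X \<B>}"

definition nowhere_dense_in :: "'a topology \<Rightarrow> 'a set \<Rightarrow> bool" where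
  "nowhere_dense_in X A \<longleftrightarrow> A \<subseteq> topspace X \<and> X interior_of (X closure_of A) = {}"

definition meagre_in :: "'a topology \<Rightarrow> 'a set \<Rightarrow> bool" where
  "meagre_in X A \<longleftrightarrow> (\<exists>\<N>. countable \<N> \<and> (\<forall>N\<in>\<N>. nowhere_dense_in X N) \<and> A = \<Union>\<N>)"

definition cantor_space :: "(nat \<Rightarrow> bool) topology" where
  "cantor_space = product_topology (\<lambda>_. discrete_topology UNIV) UNIV"

definition cov_meagre :: "(nat \<Rightarrow> bool) set rel" where
  "cov_meagre = min_card {\<A>. \<A> \<subseteq> {A. meagre_in cantor_space A} \<and> \<Union>\<A> = topspace cantor_space}"

text \<open>Both minima range over non-empty families, so the choice in \<open>min_card\<close> is never vacuous.\<close>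

lemma base_of_openin: "base_of X {U. openin X U}"
  unfolding base_of_def by (auto simp: fun_eq_iff union_of_def arbitrary_def)

lemma nowhere_dense_singleton_cantor: "nowhere_dense_in cantor_space {x}"
proof -
  have cl: "cantor_space closure_of {x} = {x}"
    unfolding cantor_space_def closure_of_eq
    by (rule closedin_Hausdorff_singleton)
      (simp_all add: Hausdorff_space_product_topology)
  have "\<not> openin cantor_space {x}"
  proof
    assume "openin cantor_space {x}"
    then obtain U where U: "finite {i. U i \<noteq> (UNIV :: bool set)}" "x \<in> PiE UNIV U" "PiE UNIV U \<subseteq> {x}"
      unfolding cantor_space_def openin_product_topology_alt by auto
    obtain i where i: "i \<notin> {i. U i \<noteq> UNIV}"
      using U(1) ex_new_if_finite infinite_UNIV_nat by blast
    then have "x(i := \<not> x i) \<in> PiE UNIV U"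
      using U(2) by (auto simp: PiE_iff)
    with U(3) have "x(i := \<not> x i) = x"
      by blast
    then show False
      by (metis fun_upd_same)
  qed
  then have "cantor_space interior_of {x} = {}"
    using interior_of_subset[of cantor_space "{x}"] openin_interior_of[of cantor_space "{x}"]
    by (cases "cantor_space interior_of {x} = {x}") (simp_all add: subset_singleton_iff)
  then show ?thesis
    by (simp add: nowhere_dense_in_def cl) (simp add: cantor_space_def)
qed

lemma weight_props:
  shows "\<exists>\<B>. base_of X \<B> \<and> weight X = |\<B>|"
    and "base_of X \<B> \<Longrightarrow> weight X \<le>o |\<B>|"
proof -
  have ne: "{\<B>. base_of X \<B>} \<noteq> {}"
    using base_of_openin by blast
  show "\<exists>\<B>. base_of X \<B> \<and> weight X = |\<B>|"
    using min_card_props(1)[OF ne] by (simp add: weight_def)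
  show "weight X \<le>o |\<B>|" if "base_of X \<B>"
    unfolding weight_def by (rule min_card_props(2)[OF ne]) (simp add: that)
qed

lemma cov_meagre_props:
  shows "\<exists>\<A>. \<A> \<subseteq> {A. meagre_in cantor_space A} \<and> \<Union>\<A> = topspace cantor_space \<and> cov_meagre = |\<A>|"
    and "\<A> \<subseteq> {A. meagre_in cantor_space A} \<Longrightarrow> \<Union>\<A> = topspace cantor_space \<Longrightarrow> cov_meagre \<le>o |\<A>|"
proof -
  let ?F = "{\<A>. \<A> \<subseteq> {A. meagre_in cantor_space A} \<and> \<Union>\<A> = topspace cantor_space}"
  have "meagre_in cantor_space {x}" for x
    unfolding meagre_in_def
    by (rule exI[of _ "{{x}}"]) (simp add: nowhere_dense_singleton_cantor)
  then have "range (\<lambda>x. {x}) \<in> ?F"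
    by (auto simp: cantor_space_def)
  then have ne: "?F \<noteq> {}"
    by (metis empty_iff)
  show "\<exists>\<A>. \<A> \<subseteq> {A. meagre_in cantor_space A} \<and> \<Union>\<A> = topspace cantor_space \<and> cov_meagre = |\<A>|"
    using min_card_props(1)[OF ne] unfolding cov_meagre_def Bex_def mem_Collect_eq conj_assoc .
  show "cov_meagre \<le>o |\<A>|"
    if "\<A> \<subseteq> {A. meagre_in cantor_space A}" "\<Union>\<A> = topspace cantor_space"
    unfolding cov_meagre_def by (rule min_card_props(2)[OF ne]) (use that in simp)
qed

end

theory Submission
  imports Defs
begin

text \<open>
  If some point \<open>p\<close> is isolated in the set \<open>D\<close> of non-isolated points of \<open>X\<close>, then a closed
  neighbourhood of \<open>p\<close> has no other non-isolated point, so all its injective sequences off \<open>p\<close> converge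
  to \<open>p\<close>. Otherwise \<open>D\<close> is dense in itself and carries a Cantor scheme of closed sets
  \<open>C s\<close>. Pick a closed set \<open>Y\<close> minimal among those meeting every \<open>C s\<close>; by minimality every open
  set that meets \<open>Y \<inter> C t\<close> contains \<open>Y \<inter> C s\<close> for some \<open>s\<close> extending \<open>t\<close>. Hence for each
  basic open \<open>U\<close> the branches along which \<open>Y \<inter> C s\<close> is never decided by \<open>U\<close> form a nowhere dense
  set. As there are fewer than \<open>cov(\<M>)\<close> basic sets, some branch is decided by all of them; along it
  the sets \<open>Y \<inter> C s\<close> shrink to a point, to which any choice of other points from them converges.
\<close>

section \<open>Initial segments in the Cantor space\<close>

text \<open>Initial segments are listed latest entry first, so that extending means consing.\<close>

definition initial_seg :: "(nat \<Rightarrow> 'b) \<Rightarrow> nat \<Rightarrow> 'b list" where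
  "initial_seg c n = rev (map c [0..<n])"

lemma length_initial_seg [simp]: "length (initial_seg c n) = n"
  by (simp add: initial_seg_def)

lemma initial_seg_Suc: "initial_seg c (Suc n) = c n # initial_seg c n"
  by (simp add: initial_seg_def)

lemma initial_seg_eq_iff: "initial_seg c n = initial_seg d n \<longleftrightarrow> (\<forall>i<n. c i = d i)"
  by (auto simp: initial_seg_def)

text \<open>The branch reads \<open>u @ t\<close> from its end, so it passes through
  \<open>t\<close> first. Entries beyond the length of the list are unspecified, but none of them is
  inspected here.\<close>

lemma initial_seg_nth_rev:
  "initial_seg (\<lambda>i. rev (u @ t) ! i) (length t) = t"
proof -
  have "map (\<lambda>i. rev (u @ t) ! i) [0..<length t] = rev t"
    by (rule nth_equalityI) (simp_all add: nth_append)
  then show ?thesis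
    by (simp add: initial_seg_def)
qed

lemma topspace_cantor_space [simp]: "topspace cantor_space = UNIV"
  by (simp add: cantor_space_def)

lemma openin_cylinder: "openin cantor_space {c. initial_seg c n = initial_seg x n}"
proof -
  define V where "V i = (if i < n then {x i} else UNIV)" for i
  have "finite {i. V i \<noteq> UNIV}"
    by (rule finite_subset[of _ "{..<n}"]) (auto simp: V_def)
  then have "openin cantor_space (PiE UNIV V)"
    unfolding cantor_space_def by (intro openin_PiE_gen[THEN iffD2]) simp
  moreover have "PiE UNIV V = {c. initial_seg c n = initial_seg x n}"
    by (auto simp: initial_seg_eq_iff V_def PiE_iff split: if_splits)
  ultimately show ?thesis by simp
qed

lemma openin_initial_seg: "openin cantor_space {c. Q (initial_seg c n)}"
proof (subst openin_subopen, intro ballI)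
  fix x assume "x \<in> {c. Q (initial_seg c n)}"
  then show "\<exists>T. openin cantor_space T \<and> x \<in> T \<and> T \<subseteq> {c. Q (initial_seg c n)}"
    by (intro exI[of _ "{c. initial_seg c n = initial_seg x n}"]) (auto simp: openin_cylinder)
qed

lemma cylinder_subset_open:
  assumes "openin cantor_space T" "x \<in> T"
  shows "\<exists>n. {c. initial_seg c n = initial_seg x n} \<subseteq> T"
proof -
  obtain U where U: "finite {i. U i \<noteq> (UNIV :: bool set)}" "x \<in> PiE UNIV U" "PiE UNIV U \<subseteq> T"
    using assms unfolding cantor_space_def openin_product_topology_alt by auto
  obtain n where n: "\<And>i. U i \<noteq> UNIV \<Longrightarrow> i < n"
    using U(1) finite_nat_set_iff_bounded by auto
  have "c \<in> PiE UNIV U" if "initial_seg c n = initial_seg x n" for c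
  proof -
    have "c i \<in> U i" for i
      using n[of i] U(2) that by (cases "U i = UNIV") (auto simp: initial_seg_eq_iff PiE_iff)
    then show ?thesis by auto
  qed
  then show ?thesis using U(3) by blast
qed

text \<open>The set is closed, because membership in its complement is witnessed by a finite initial
  segment. It contains no cylinder, because every segment \<open>t\<close> has an extension
  satisfying \<open>Q\<close>.\<close>

lemma nowhere_dense_avoiding:
  assumes "\<And>t. \<exists>u. Q (u @ t)"
  shows "nowhere_dense_in cantor_space {c. \<forall>n. \<not> Q (initial_seg c n)}"
proof -
  let ?N = "{c. \<forall>n. \<not> Q (initial_seg c n)}"
  have "openin cantor_space (\<Union>n. {c. Q (initial_seg c n)})"
    by (intro openin_Union) (auto simp: openin_initial_seg)
  moreover have "UNIV - ?N = (\<Union>n. {c. Q (initial_seg c n)})"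
    by auto
  ultimately have "closedin cantor_space ?N"
    by (simp add: closedin_def)
  moreover have "cantor_space interior_of ?N = {}"
  proof (rule ccontr)
    assume "cantor_space interior_of ?N \<noteq> {}"
    then obtain x where "x \<in> cantor_space interior_of ?N"
      by blast
    then obtain n where "{c. initial_seg c n = initial_seg x n} \<subseteq> cantor_space interior_of ?N"
      using cylinder_subset_open[OF openin_interior_of] by blast
    then have n: "{c. initial_seg c n = initial_seg x n} \<subseteq> ?N"
      by (rule order_trans[OF _ interior_of_subset])
    obtain u where u: "Q (u @ initial_seg x n)"
      using assms by blast
    \<comment> \<open>A branch that starts with \<open>initial_seg x n\<close> and satisfies
      \<open>Q\<close> after \<open>length u\<close> further entries.\<close>
    let ?c = "\<lambda>i. rev (u @ initial_seg x n) ! i"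
    have "?c \<in> ?N"
      using n initial_seg_nth_rev[of u "initial_seg x n"] by auto
    then have "\<not> Q (initial_seg ?c (length (u @ initial_seg x n)))"
      by blast
    then show False
      using u initial_seg_nth_rev[of "[]" "u @ initial_seg x n"] by simp
  qed
  ultimately show ?thesis
    by (simp add: nowhere_dense_in_def closure_of_closedin)
qed

lemma exists_outside_few_nowhere_dense:
  assumes "|\<B>| <o cov_meagre" and "\<And>U. U \<in> \<B> \<Longrightarrow> nowhere_dense_in cantor_space (N U)"
  shows "\<exists>c. \<forall>U\<in>\<B>. c \<notin> N U"
proof (rule ccontr)
  assume "\<nexists>c. \<forall>U\<in>\<B>. c \<notin> N U"
  then have "\<Union> (N ` \<B>) = topspace cantor_space"
    by auto
  moreover have "N ` \<B> \<subseteq> {A. meagre_in cantor_space A}"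
  proof (clarify)
    fix U assume "U \<in> \<B>"
    then show "meagre_in cantor_space (N U)"
      unfolding meagre_in_def using assms(2) by (intro exI[of _ "{N U}"]) simp
  qed
  ultimately have "cov_meagre \<le>o |N ` \<B>|"
    by (intro cov_meagre_props(2))
  also have "|N ` \<B>| \<le>o |\<B>|"
    by (rule card_of_image)
  finally show False
    using assms(1) not_ordLess_ordLeq by blast
qed

section \<open>Cantor schemes in compact spaces\<close>

text \<open>Nothing forces the sets to shrink to points along branches; only their traces on the
  minimal set \<open>Y\<close> will do so, along a well-chosen branch.\<close>

locale cantor_scheme =
  fixes X :: "'a topology" and C :: "bool list \<Rightarrow> 'a set"
  assumes compact: "compact_space X"
    and Hausdorff: "Hausdorff_space X"
    and closed: "closedin X (C s)"
    and nonempty: "C s \<noteq> {}"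
    and Cons_subset: "C (b # s) \<subseteq> C s"
    and children_disjoint: "C (True # s) \<inter> C (False # s) = {}"
begin

lemma append_subset: "C (u @ s) \<subseteq> C s"
proof (induction u)
  case (Cons b u)
  then show ?case
    using Cons_subset[of b "u @ s"] by simp
qed simp

lemma level_disjoint:
  assumes "length s = length t" "s \<noteq> t"
  shows "C s \<inter> C t = {}"
  using assms
proof (induction s t rule: list_induct2)
  case Nil
  then show ?case by simp
next
  case (Cons a s b t)
  show ?case
  proof (cases "s = t")
    case True
    then have "b = (\<not> a)" using Cons.prems by auto
    then show ?thesis using True children_disjoint[of t] by (cases a) auto
  next
    case False
    then show ?thesis using Cons.IH Cons_subset by blast
  qed
qed

lemma decseq_branch: "decseq (\<lambda>n. C (initial_seg c n))"
  by (rule decseq_SucI) (simp add: initial_seg_Suc Cons_subset)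

text \<open>\<open>W\<close> is the complement of the minimal closed set \<open>Y\<close>, so \<open>Y \<inter> C s \<subseteq> U\<close> reads \<open>C s \<subseteq> W \<union> U\<close>.\<close>

lemma exists_maximal_open:
  "\<exists>W. openin X W \<and> (\<forall>s. \<not> C s \<subseteq> W) \<and>
     (\<forall>V. openin X V \<and> W \<subseteq> V \<and> (\<forall>s. \<not> C s \<subseteq> V) \<longrightarrow> V = W)"
proof -
  let ?\<A> = "{W. openin X W \<and> (\<forall>s. \<not> C s \<subseteq> W)}"
  have "\<exists>M\<in>?\<A>. \<forall>V\<in>?\<A>. M \<subseteq> V \<longrightarrow> V = M"
  proof (rule subset_Zorn_nonempty)
    show "?\<A> \<noteq> {}"
      using nonempty by (auto intro!: exI[of _ "{}"])
  next
    fix \<C> assume chain: "subset.chain ?\<A> \<C>"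
    have sub: "\<C> \<subseteq> ?\<A>"
      using chain by (simp add: subset_chain_def)
    \<comment> \<open>By compactness a finite part of the chain would already cover
      \<open>C s\<close>, and a nonempty finite chain contains its own union.\<close>
    have "\<not> C s \<subseteq> \<Union>\<C>" for s
    proof
      assume "C s \<subseteq> \<Union>\<C>"
      moreover have "compactin X (C s)"
        using closed closedin_compact_space compact by blast
      ultimately obtain \<F> where \<F>: "finite \<F>" "\<F> \<subseteq> \<C>" "C s \<subseteq> \<Union>\<F>"
        using sub unfolding compactin_def by (metis (no_types, lifting) mem_Collect_eq subset_iff)
      have "\<F> \<noteq> {}"
        using \<F>(3) nonempty[of s] by auto
      moreover have "subset.chain ?\<A> \<F>"
        unfolding subset_chain_def
      proof (intro conjI ballI)
        show "\<F> \<subseteq> ?\<A>"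
          using \<F>(2) sub by (rule order_trans)
      next
        fix V V' assume "V \<in> \<F>" "V' \<in> \<F>"
        then show "V \<subseteq> V' \<or> V' \<subseteq> V"
          using chain \<F>(2) unfolding subset_chain_def by (meson subsetD)
      qed
      ultimately have "\<Union>\<F> \<in> \<F>"
        using \<F>(1) by (intro Union_in_chain)
      then show False
        using \<F> sub by blast
    qed
    then show "\<Union>\<C> \<in> ?\<A>"
      using sub by (auto intro!: openin_Union)
  qed
  then obtain M where "M \<in> ?\<A>" and "\<forall>V\<in>?\<A>. M \<subseteq> V \<longrightarrow> V = M"
    by (rule bexE)
  then show ?thesis
    by (intro exI[of _ M]) simp
qed

text \<open>By maximality, adding to \<open>W\<close> an open set not inside it makes it swallow
  some \<open>C s\<close>. Adding \<open>U\<close> with the other sets of the level of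
  \<open>t\<close> removed forces \<open>s\<close> to be compatible with \<open>t\<close>.\<close>

lemma maximal_open_refine:
  assumes W: "openin X W" "\<And>s. \<not> C s \<subseteq> W"
    and max: "\<And>V. openin X V \<Longrightarrow> W \<subseteq> V \<Longrightarrow> (\<And>s. \<not> C s \<subseteq> V) \<Longrightarrow> V = W"
    and U: "openin X U" "\<not> C t \<inter> U \<subseteq> W"
  shows "\<exists>u. C (u @ t) \<subseteq> W \<union> U"
proof -
  define R where "R = {r :: bool list. length r = length t \<and> r \<noteq> t}"
  have "finite R"
    by (rule finite_subset[OF _ finite_lists_length_eq[of UNIV "length t"]]) (auto simp: R_def)
  then have clR: "closedin X (\<Union>(C ` R))"
    by (intro closedin_Union) (auto simp: closed)
  define V where "V = U - \<Union>(C ` R)"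
  have V: "openin X V"
    unfolding V_def using U(1) clR by (rule openin_diff)
  have "C t \<inter> U \<subseteq> V"
    using level_disjoint[of _ t] by (auto simp: V_def R_def)
  then have "W \<union> V \<noteq> W"
    using U(2) by blast
  then obtain s where s: "C s \<subseteq> W \<union> V"
    using max[of "W \<union> V"] W(1) V by blast
  \<comment> \<open>If \<open>s\<close> is shorter than \<open>t\<close>, padding lifts it to the
    level of \<open>t\<close>; otherwise the truncated difference is 0 and nothing is added.\<close>
  define s' where "s' = replicate (length t - length s) False @ s"
  have s': "C s' \<subseteq> W \<union> V"
    using s append_subset unfolding s'_def by blast
  define u r where "u = take (length s' - length t) s'" and "r = drop (length s' - length t) s'"
  have ur: "s' = u @ r"
    by (simp add: u_def r_def)
  have "length t \<le> length s'"
    by (simp add: s'_def)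
  then have len: "length r = length t"
    by (simp add: r_def)
  \<comment> \<open>Otherwise \<open>C s'\<close> lies in one of the removed sets, so it misses
    \<open>V\<close> and is contained in \<open>W\<close> alone.\<close>
  have "r = t"
  proof (rule ccontr)
    assume "r \<noteq> t"
    then have "r \<in> R"
      using len by (simp add: R_def)
    moreover have "C s' \<subseteq> C r"
      using append_subset ur by simp
    ultimately have "C s' \<inter> V = {}"
      by (auto simp: V_def)
    then show False
      using s' W(2)[of s'] by blast
  qed
  then show ?thesis
    using s' ur by (auto simp: V_def)
qed

lemma nontrivial_sequence:
  assumes "weight X <o cov_meagre"
  shows "\<exists>a l. (\<forall>n. a n \<in> topspace X \<and> a n \<noteq> l) \<and> limitin X a l sequentially"
proof -
  obtain W where W: "openin X W" "\<And>s. \<not> C s \<subseteq> W"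
    and max: "\<And>V. openin X V \<Longrightarrow> W \<subseteq> V \<Longrightarrow> (\<And>s. \<not> C s \<subseteq> V) \<Longrightarrow> V = W"
    using exists_maximal_open by metis
  obtain \<B> where \<B>: "base_of X \<B>" "weight X = |\<B>|"
    using weight_props(1) by blast
  have opn: "openin X U" if "U \<in> \<B>" for U
    using \<B>(1) that by (simp add: base_of_def arbitrary_union_of_inc)
  \<comment> \<open>The disjuncts say that the trace of \<open>Y\<close> on
    \<open>C (initial_seg c n)\<close> lies inside \<open>U\<close> or misses
    \<open>U\<close>.\<close>
  have "\<exists>c. \<forall>U\<in>\<B>. c \<notin> {c. \<forall>n. \<not> (C (initial_seg c n) \<subseteq> W \<union> U \<or> C (initial_seg c n) \<inter> U \<subseteq> W)}"
  proof (rule exists_outside_few_nowhere_dense)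
    show "|\<B>| <o cov_meagre"
      using assms \<B>(2) by simp
  next
    fix U assume "U \<in> \<B>"
    have "\<exists>u. C (u @ t) \<subseteq> W \<union> U \<or> C (u @ t) \<inter> U \<subseteq> W" for t
    proof (cases "C t \<inter> U \<subseteq> W")
      case True
      then show ?thesis by (intro exI[of _ "[]"]) simp
    next
      case False
      then show ?thesis
        using maximal_open_refine[OF W max opn[OF \<open>U \<in> \<B>\<close>]] by blast
    qed
    then show "nowhere_dense_in cantor_space
        {c. \<forall>n. \<not> (C (initial_seg c n) \<subseteq> W \<union> U \<or> C (initial_seg c n) \<inter> U \<subseteq> W)}"
      by (rule nowhere_dense_avoiding)
  qed
  then obtain c where c: "\<And>U. U \<in> \<B> \<Longrightarrow>
      \<exists>n. C (initial_seg c n) \<subseteq> W \<union> U \<or> C (initial_seg c n) \<inter> U \<subseteq> W"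
    by blast
  define K where "K n = C (initial_seg c n) - W" for n
  have decK: "decseq K"
    using decseq_branch[of c] unfolding K_def decseq_def by blast
  have "(\<Inter>n. K n) \<noteq> {}"
    using W by (intro compact_space_imp_nest[OF compact] decK) (auto simp: K_def closed)
  then obtain l where l: "\<And>n. l \<in> K n"
    by blast
  \<comment> \<open>Both children of the node meet \<open>Y\<close>, and they are disjoint, so
    \<open>K n\<close> has at least two points.\<close>
  have "\<exists>x. x \<in> K n \<and> x \<noteq> l" for n
  proof -
    obtain x y where "x \<in> C (True # initial_seg c n) - W" "y \<in> C (False # initial_seg c n) - W"
      using W(2) by blast
    then show ?thesis
      using children_disjoint[of "initial_seg c n"] Cons_subset[of _ "initial_seg c n"]
      unfolding K_def by blast
  qed
  then obtain a where a: "\<And>n. a n \<in> K n" "\<And>n. a n \<noteq> l"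
    by metis
  have topK: "K n \<subseteq> topspace X" for n
    using closedin_subset[OF closed] by (auto simp: K_def)
  have "limitin X a l sequentially"
    unfolding limitin_def
  proof (intro conjI allI impI)
    show "l \<in> topspace X"
      using l topK by blast
  next
    fix V assume "openin X V \<and> l \<in> V"
    then obtain U where U: "U \<in> \<B>" "l \<in> U" "U \<subseteq> V"
      using \<B>(1) unfolding base_of_def union_of_def arbitrary_def by auto
    \<comment> \<open>The other alternative would put \<open>l\<close>, which lies in
      \<open>U\<close> and in every \<open>K n\<close>, into \<open>W\<close>.\<close>
    obtain n where "C (initial_seg c n) \<subseteq> W \<union> U"
      using c[OF U(1)] U(2) l unfolding K_def by blast
    then have "K n \<subseteq> V"
      using U(3) by (auto simp: K_def)
    then have "a m \<in> V" if "m \<ge> n" for m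
      using a(1)[of m] decK that unfolding decseq_def by blast
    then show "\<forall>\<^sub>F m in sequentially. a m \<in> V"
      unfolding eventually_sequentially by blast
  qed
  then show ?thesis
    using a topK by blast
qed

end

text \<open>Each node carries an open set meeting \<open>D\<close>. It contains two points of
  \<open>D\<close>, as no point is isolated in \<open>D\<close>; by regularity these have open
  neighbourhoods whose closures are disjoint and stay inside it. The scheme consists of the
  closures.\<close>

lemma cantor_scheme_of_dense_in_itself:
  assumes "compact_space X" "Hausdorff_space X" "D \<noteq> {}" "D \<subseteq> X derived_set_of D"
  shows "\<exists>C. cantor_scheme X C"
proof -
  define P where "P U \<longleftrightarrow> openin X U \<and> U \<inter> D \<noteq> {}" for U
  have nb: "\<exists>V. openin X V \<and> p \<in> V \<and> X closure_of V \<subseteq> G" if "openin X G" "p \<in> G" for p G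
  proof -
    have "neighbourhood_base_of (closedin X) X"
      using assms(1,2) compact_Hausdorff_imp_regular_space neighbourhood_base_of_closedin by blast
    then obtain V F where "openin X V" "closedin X F" "p \<in> V" "V \<subseteq> F" "F \<subseteq> G"
      using \<open>openin X G\<close> \<open>p \<in> G\<close> unfolding neighbourhood_base_of by metis
    then show ?thesis
      by (meson closure_of_minimal order_trans)
  qed
  have "\<exists>f :: bool \<Rightarrow> 'a set. P (f True) \<and> P (f False) \<and> X closure_of f True \<subseteq> U \<and>
      X closure_of f False \<subseteq> U \<and> X closure_of f True \<inter> X closure_of f False = {}" if PU: "P U" for U
  proof -
    obtain p where p: "p \<in> U" "p \<in> D" and U: "openin X U"
      using PU by (auto simp: P_def)
    then obtain q where q: "q \<in> U" "q \<in> D" "q \<noteq> p"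
      using assms(4) unfolding derived_set_of_def by blast
    obtain G H where GH: "openin X G" "openin X H" "p \<in> G" "q \<in> H" "disjnt G H"
      using assms(2) p q openin_subset[OF U] unfolding Hausdorff_space_def by (metis subset_iff)
    obtain V where V: "openin X V" "p \<in> V" "X closure_of V \<subseteq> U \<inter> G"
      using nb[of "U \<inter> G" p] U GH p by auto
    obtain V' where V': "openin X V'" "q \<in> V'" "X closure_of V' \<subseteq> U \<inter> H"
      using nb[of "U \<inter> H" q] U GH q by auto
    show ?thesis
      using V V' GH(5) p q
      by (intro exI[of _ "\<lambda>b. if b then V else V'"]) (auto simp: P_def disjnt_def)
  qed
  then obtain f where f: "\<And>U. P U \<Longrightarrow> P (f U True) \<and> P (f U False) \<and> X closure_of f U True \<subseteq> U \<and>
      X closure_of f U False \<subseteq> U \<and> X closure_of f U True \<inter> X closure_of f U False = {}"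
    by metis
  \<comment> \<open>\<open>foldr\<close> applies the head of the list last, so consing a bit passes
    to a child.\<close>
  define G where "G s = foldr (\<lambda>b U. f U b) s (topspace X)" for s
  have G_Cons: "G (b # s) = f (G s) b" for b s
    by (simp add: G_def)
  have PG: "P (G s)" for s
  proof (induction s)
    case Nil
    show ?case
      using assms(3,4) derived_set_of_subset_topspace[of X D] by (auto simp: G_def P_def)
  next
    case (Cons b s)
    then show ?case
      using f[of "G s"] by (cases b) (auto simp: G_Cons)
  qed
  have sub: "G s \<subseteq> X closure_of G s" for s
    using PG by (intro closure_of_subset) (simp add: P_def openin_subset)
  have "cantor_scheme X (\<lambda>s. X closure_of G s)"
  proof
    show "X closure_of G s \<noteq> {}" for s
      using PG[of s] sub[of s] by (auto simp: P_def)
    show "X closure_of G (b # s) \<subseteq> X closure_of G s" for b s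
      using f[OF PG[of s]] sub[of s] by (cases b) (auto simp: G_Cons)
    show "X closure_of G (True # s) \<inter> X closure_of G (False # s) = {}" for s
      using f[OF PG[of s]] by (simp add: G_Cons)
  qed (use assms in auto)
  then show ?thesis by blast
qed

section \<open>Convergent sequences\<close>

text \<open>Accumulation points of \<open>F\<close> are accumulation points of the whole space, so
  the compact set \<open>F\<close> is discrete.\<close>

lemma finite_closedin_of_isolated:
  assumes "compact_space X" "closedin X F" "F \<inter> X derived_set_of topspace X = {}"
  shows "finite F"
proof -
  have "compactin X F"
    using assms closedin_compact_space by blast
  moreover have "F \<inter> X derived_set_of F = {}"
    using assms(3) derived_set_of_mono[OF closedin_subset[OF assms(2)]] by blast
  ultimately show ?thesis
    using discrete_compactin_eq_finite by blast
qed

lemma sequence_to_relatively_isolated: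
  assumes "compact_space X" "Hausdorff_space X"
    and p: "p \<in> X derived_set_of topspace X"
           "p \<notin> X derived_set_of (X derived_set_of topspace X)"
  shows "\<exists>a. (\<forall>n. a n \<in> topspace X \<and> a n \<noteq> p) \<and> limitin X a p sequentially"
proof -
  let ?D = "X derived_set_of topspace X"
  have ptop: "p \<in> topspace X"
    using p(1) derived_set_of_subset_topspace[of X] by blast
  obtain G where G: "openin X G" "p \<in> G" "G \<inter> ?D \<subseteq> {p}"
    using p(2) ptop unfolding derived_set_of_def[of X ?D] by blast
  have "neighbourhood_base_of (closedin X) X"
    using assms(1,2) compact_Hausdorff_imp_regular_space neighbourhood_base_of_closedin by blast
  then obtain V F where VF: "openin X V" "closedin X F" "p \<in> V" "V \<subseteq> F" "F \<subseteq> G"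
    using G unfolding neighbourhood_base_of by metis
  have "infinite (V \<inter> topspace X)"
    using p(1) VF(1,3) assms(2) derived_set_of_infinite_openin[of X "topspace X"]
    by (auto simp: Int_commute)
  then have "infinite (V - {p})"
    by auto
  then obtain a :: "nat \<Rightarrow> 'a" where a: "inj a" "range a \<subseteq> V - {p}"
    using infinite_countable_subset by blast
  have "limitin X a p sequentially"
    unfolding limitin_def
  proof (intro conjI allI impI ptop)
    fix U assume U: "openin X U \<and> p \<in> U"
    \<comment> \<open>\<open>F\<close> lies in \<open>G\<close>, where only \<open>p\<close> can be
      non-isolated, and \<open>p\<close> belongs to \<open>U\<close>.\<close>
    then have "finite (F - U)"
      using VF G(3) by (intro finite_closedin_of_isolated[OF assms(1)]) auto
    then have "finite (a -` (F - U))"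
      using a(1) by (rule finite_vimageI)
    then have "\<forall>\<^sub>F n in sequentially. n \<notin> a -` (F - U)"
      by (simp add: eventually_cofinite vimage_def flip: cofinite_eq_sequentially)
    then show "\<forall>\<^sub>F n in sequentially. a n \<in> U"
      by eventually_elim (use a(2) VF(4) in auto)
  qed
  then show ?thesis
    using a(2) VF(1) openin_subset by blast
qed

theorem theorem2p7p10:
  fixes X :: "'a topology"
  assumes "infinite (topspace X)"
    and "compact_space X"
    and "Hausdorff_space X"
    and "weight X <o cov_meagre"
  shows "\<exists>(a :: nat \<Rightarrow> 'a) l.
    (\<forall>n. a n \<in> topspace X) \<and>
    \<not> (\<exists>c. \<forall>\<^sub>F n in sequentially. a n = c) \<and>
    limitin X a l sequentially"
proof -
  let ?D = "X derived_set_of topspace X"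
  have "?D \<noteq> {}"
    using finite_closedin_of_isolated[of X "topspace X"] assms(1,2) by auto
  have "\<exists>a l. (\<forall>n. a n \<in> topspace X \<and> a n \<noteq> l) \<and> limitin X a l sequentially"
  proof (cases "?D \<subseteq> X derived_set_of ?D")
    case True
    then obtain C where "cantor_scheme X C"
      using cantor_scheme_of_dense_in_itself[OF assms(2,3) \<open>?D \<noteq> {}\<close>] by blast
    then show ?thesis
      using cantor_scheme.nontrivial_sequence assms(4) by blast
  next
    case False
    then show ?thesis
      using sequence_to_relatively_isolated[OF assms(2,3)] by blast
  qed
  then obtain a l where a: "\<And>n. a n \<in> topspace X" "\<And>n. a n \<noteq> l" "limitin X a l sequentially"
    by blast
  have "\<not> (\<exists>c. \<forall>\<^sub>F n in sequentially. a n = c)"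
  proof
    assume "\<exists>c. \<forall>\<^sub>F n in sequentially. a n = c"
    then obtain c where c: "\<forall>\<^sub>F n in sequentially. a n = c"
      by blast
    \<comment> \<open>The constant \<open>c\<close> is itself a term of the sequence and hence
      differs from \<open>l\<close>.\<close>
    then obtain m where m: "a m = c"
      using eventually_sequentially by auto
    have "openin X (topspace X - {c})" "l \<in> topspace X - {c}"
      using a m assms(3) limitin_topspace[OF a(3)]
      by (auto intro!: openin_diff closedin_Hausdorff_singleton)
    then have "\<forall>\<^sub>F n in sequentially. a n \<in> topspace X - {c}"
      using a(3) unfolding limitin_def by blast
    with c have "\<forall>\<^sub>F n in sequentially. False"
      by eventually_elim auto
    then show False by simp
  qed
  then show ?thesis
    using a by blast
qed

end
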